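(* Let $f:\mathbb{N}\to\mathbb{R}$ be a superpolynomial function with $f(r)\ge 3r+1$ for every $r\in\mathbb{N}$. Then the class of graphs with growth at most $f$ has unbounded asymptotic dimension, i.e.\ for no integer $n$ does it have asymptotic dimension at most $n$.
   Context: A function $f$ is superpolynomial if it can be written as $f(r)=r^{g(r)}$ with $g(r)\to\infty$ as $r\to\infty$. A graph has growth at most $f$ if for every integer $r$ and every vertex $v$, at most $f(r)$ vertices are at shortest-path distance at most $r$ from $v$. Graphs are metric spaces with the shortest-path distance. For a metric space $(X,d)$, a family $\mathcal U$ of subsets is $D$-bounded if every member has diameter at most $D$, and $r$-disjoint if points in different members are at distance $>r$. A function $D:\mathbb{R}^+\to\mathbb{R}^+$ is an $n$-dimensional control function for $X$ if for every $r>0$ there is a cover $\mathcal U=\mathcal U_1\cup\dots\cup\mathcal U_{n+1}$ of $X$ with each $\mathcal U_i$ $r$-disjoint and each member $D(r)$-bounded; a class has asymptotic dimension at most $n$ if one such function works for all its members. *)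

theory Defs
  imports Complex_Main "HOL-Library.Extended_Nat"
begin

record 'a graph =
  verts :: "'a set"
  adj :: "'a \<Rightarrow> 'a \<Rightarrow> bool"

definition is_graph :: "'a graph \<Rightarrow> bool" where
  "is_graph G \<longleftrightarrow>
     (\<forall>u v. adj G u v \<longrightarrow> u \<in> verts G \<and> v \<in> verts G) \<and>
     (\<forall>u v. adj G u v \<longrightarrow> adj G v u) \<and>
     (\<forall>u. \<not> adj G u u)"

definition walk_len :: "'a graph \<Rightarrow> 'a \<Rightarrow> 'a \<Rightarrow> nat \<Rightarrow> bool" where
  "walk_len G u v k \<longleftrightarrow>
     (\<exists>xs. length xs = Suc k \<and> hd xs = u \<and> last xs = v \<and> set xs \<subseteq> verts G \<and>
           (\<forall>i < k. adj G (xs ! i) (xs ! Suc i)))"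

text \<open>Shortest-path distance (infinite if no path).\<close>
definition gdist :: "'a graph \<Rightarrow> 'a \<Rightarrow> 'a \<Rightarrow> enat" where
  "gdist G u v = (INF k \<in> {k. walk_len G u v k}. enat k)"

definition ball :: "'a graph \<Rightarrow> 'a \<Rightarrow> nat \<Rightarrow> 'a set" where
  "ball G v r = {u \<in> verts G. gdist G v u \<le> enat r}"

definition growth_at_most :: "(nat \<Rightarrow> real) \<Rightarrow> 'a graph \<Rightarrow> bool" where
  "growth_at_most f G \<longleftrightarrow>
     (\<forall>r. \<forall>v \<in> verts G. finite (ball G v r) \<and> real (card (ball G v r)) \<le> f r)"

definition superpolynomial :: "(nat \<Rightarrow> real) \<Rightarrow> bool" where
  "superpolynomial f \<longleftrightarrow>
     (\<exists>g :: nat \<Rightarrow> real. filterlim g at_top sequentially \<and>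
        (\<forall>\<^sub>F r in sequentially. f r = real r powr g r))"

definition D_bounded :: "'a graph \<Rightarrow> real \<Rightarrow> 'a set set \<Rightarrow> bool" where
  "D_bounded G D \<U> \<longleftrightarrow>
     (\<forall>U \<in> \<U>. \<forall>x \<in> U. \<forall>y \<in> U. \<exists>k. gdist G x y = enat k \<and> real k \<le> D)"

definition r_disjoint :: "'a graph \<Rightarrow> real \<Rightarrow> 'a set set \<Rightarrow> bool" where
  "r_disjoint G r \<U> \<longleftrightarrow>
     (\<forall>U \<in> \<U>. \<forall>U' \<in> \<U>. U \<noteq> U' \<longrightarrow>
        (\<forall>x \<in> U. \<forall>y \<in> U'. \<forall>k. gdist G x y = enat k \<longrightarrow> real k > r))"

definition control_function :: "'a graph \<Rightarrow> nat \<Rightarrow> (real \<Rightarrow> real) \<Rightarrow> bool" where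
  "control_function G n D \<longleftrightarrow>
     (\<forall>r > 0. \<exists>\<U> :: nat \<Rightarrow> 'a set set.
        (\<forall>i \<le> n. \<forall>U \<in> \<U> i. U \<subseteq> verts G) \<and>
        verts G = (\<Union>i \<le> n. \<Union>(\<U> i)) \<and>
        (\<forall>i \<le> n. r_disjoint G r (\<U> i) \<and> D_bounded G (D r) (\<U> i)))"

definition asdim_class_le :: "('a graph \<Rightarrow> bool) \<Rightarrow> nat \<Rightarrow> bool" where
  "asdim_class_le C n \<longleftrightarrow>
     (\<exists>D :: real \<Rightarrow> real. (\<forall>r > 0. D r > 0) \<and> (\<forall>G. C G \<longrightarrow> control_function G n D))"

end

theory Submission
  imports Defs "HOL-Analysis.Brouwer_Fixpoint" "HOL-Library.Nat_Bijection"
begin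

text \<open>
  In a cubic graph of dimension d + 1 whose edges are all subdivided into paths of length l, a ball of
  radius r < l / 2 contains at most one branch vertex and hence at most 3 r + 1 vertices, whereas larger
  balls have at most (2 r + 1)^(d + 1) vertices, a bound independent of l. As f is superpolynomial, a
  large l therefore makes the growth at most f. The subdivision does not affect the large-scale geometry:
  the graph still contains a coarse copy of the d-dimensional grid, whose asymptotic dimension is at
  least d because, by Kuhn's lemma, a large cube of the grid cannot be covered by d families of
  uniformly bounded, well separated sets.
\<close>

section \<open>Walks, distances and balls\<close>

lemma walk_len_0:
  "u \<in> verts G \<Longrightarrow> walk_len G u u 0"
  unfolding walk_len_def by (rule exI[of _ "[u]"]) auto

lemma walk_len_verts:
  assumes "walk_len G u v k"
  shows "u \<in> verts G" "v \<in> verts G"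
proof -
  obtain xs where "length xs = Suc k" "hd xs = u" "last xs = v" "set xs \<subseteq> verts G"
    using assms unfolding walk_len_def by blast
  moreover from this have "xs \<noteq> []" by auto
  ultimately show "u \<in> verts G" "v \<in> verts G"
    using hd_in_set last_in_set by blast+
qed

lemma walk_len_0_iff:
  "walk_len G u v 0 \<longleftrightarrow> u = v \<and> u \<in> verts G"
proof
  assume w: "walk_len G u v 0"
  then obtain xs where "length xs = Suc 0" "hd xs = u" "last xs = v"
    unfolding walk_len_def by blast
  then have "u = v" by (auto simp: length_Suc_conv)
  then show "u = v \<and> u \<in> verts G" using walk_len_verts[OF w] by simp
qed (auto intro: walk_len_0)

lemma walk_len_snoc:
  assumes "walk_len G u v k" "adj G v w" "w \<in> verts G"
  shows "walk_len G u w (Suc k)"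
proof -
  obtain xs where xs: "length xs = Suc k" "hd xs = u" "last xs = v" "set xs \<subseteq> verts G"
    "\<forall>i<k. adj G (xs ! i) (xs ! Suc i)"
    using assms unfolding walk_len_def by blast
  have ne: "xs \<noteq> []" using xs by auto
  have lst: "xs ! k = v" using xs ne by (simp add: last_conv_nth)
  have "adj G ((xs @ [w]) ! i) ((xs @ [w]) ! Suc i)" if "i < Suc k" for i
  proof (cases "i = k")
    case True then show ?thesis using xs lst assms by (simp add: nth_append)
  next
    case False then show ?thesis using xs that by (simp add: nth_append)
  qed
  then show ?thesis
    unfolding walk_len_def using xs ne assms by (intro exI[of _ "xs @ [w]"]) auto
qed

lemma walk_len_Suc_split:
  assumes "walk_len G u v (Suc k)"
  obtains w where "walk_len G u w k" "adj G w v" "v \<in> verts G"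
proof -
  obtain xs where xs: "length xs = Suc (Suc k)" "hd xs = u" "last xs = v" "set xs \<subseteq> verts G"
    "\<forall>i<Suc k. adj G (xs ! i) (xs ! Suc i)"
    using assms unfolding walk_len_def by blast
  have ne: "xs \<noteq> []" using xs by auto
  have "xs ! Suc k = v" using xs ne by (simp add: last_conv_nth)
  then have "adj G (xs ! k) v" using xs by auto
  moreover have "walk_len G u (xs ! k) k"
    unfolding walk_len_def
  proof (intro exI[of _ "take (Suc k) xs"] conjI)
    show "last (take (Suc k) xs) = xs ! k"
      using xs ne by (subst last_conv_nth) auto
    show "set (take (Suc k) xs) \<subseteq> verts G"
      using xs set_take_subset by fastforce
  qed (use xs in auto)
  ultimately show ?thesis using that walk_len_verts[OF assms] by blast
qed

lemma walk_len_trans: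
  assumes "walk_len G u v k" "walk_len G v w m"
  shows "walk_len G u w (k + m)"
  using assms(2)
proof (induction m arbitrary: w)
  case 0
  then show ?case using assms(1) by (simp add: walk_len_0_iff)
next
  case (Suc m)
  from Suc.prems obtain x where "walk_len G v x m" "adj G x w" "w \<in> verts G"
    by (rule walk_len_Suc_split)
  then show ?case using Suc.IH walk_len_snoc by fastforce
qed

lemma walk_len_sym:
  assumes "is_graph G" "walk_len G u v k"
  shows "walk_len G v u k"
  using assms(2)
proof (induction k arbitrary: v)
  case 0
  then show ?case by (auto simp: walk_len_0_iff)
next
  case (Suc k)
  from Suc.prems obtain x where x: "walk_len G u x k" "adj G x v" "v \<in> verts G"
    by (rule walk_len_Suc_split)
  have "x \<in> verts G" "adj G v x" using x walk_len_verts assms(1) unfolding is_graph_def by blast+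
  then have "walk_len G v x (Suc 0)"
    using x by (intro walk_len_snoc[OF walk_len_0])
  from walk_len_trans[OF this Suc.IH[OF x(1)]] show ?case by simp
qed

text \<open>A finite infimum of natural numbers is attained, so a distance bound amounts to a short
  walk; with no walk at all the infimum is infinite and both sides fail.\<close>

lemma gdist_le_iff:
  "gdist G u v \<le> enat r \<longleftrightarrow> (\<exists>k\<le>r. walk_len G u v k)"
proof
  assume le: "gdist G u v \<le> enat r"
  \<comment> \<open>A strict bound on the infimum is what yields a walk below it.\<close>
  have "gdist G u v < enat (Suc r)"
    using le by (rule order.strict_trans1) simp
  then obtain k where "walk_len G u v k" "enat k < enat (Suc r)"
    unfolding gdist_def by (auto simp: INF_less_iff)
  then show "\<exists>k\<le>r. walk_len G u v k" by (auto simp: less_Suc_eq_le)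
next
  assume "\<exists>k\<le>r. walk_len G u v k"
  then obtain k where "k \<le> r" "walk_len G u v k" by blast
  then show "gdist G u v \<le> enat r"
    unfolding gdist_def by (intro INF_lower2[of k]) auto
qed

lemma gdist_sym:
  assumes "is_graph G"
  shows "gdist G u v = gdist G v u"
proof -
  have "walk_len G u v = walk_len G v u"
    using walk_len_sym[OF assms] by blast
  then show ?thesis unfolding gdist_def by simp
qed

lemma gdist_le_trans:
  assumes "gdist G u v \<le> enat a" "gdist G v w \<le> enat b"
  shows "gdist G u w \<le> enat (a + b)"
  using assms walk_len_trans unfolding gdist_le_iff by (meson add_mono)

lemma gdist_le_mono:
  "gdist G u v \<le> enat a \<Longrightarrow> a \<le> b \<Longrightarrow> gdist G u v \<le> enat b"
  by (meson enat_ord_simps(1) order.trans)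

lemma gdist_adj:
  assumes "is_graph G" "adj G u v"
  shows "gdist G u v \<le> enat 1"
proof -
  have "walk_len G u v (Suc 0)"
    using assms unfolding is_graph_def by (intro walk_len_snoc[OF walk_len_0]) blast+
  then show ?thesis unfolding gdist_le_iff by auto
qed

lemma ball_0:
  "v \<in> verts G \<Longrightarrow> Defs.ball G v 0 = {v}"
  unfolding Defs.ball_def by (auto simp: gdist_le_iff walk_len_0_iff)

lemma ball_mono:
  "a \<le> b \<Longrightarrow> Defs.ball G v a \<subseteq> Defs.ball G v b"
  unfolding Defs.ball_def using gdist_le_mono by fast

lemma ball_adj:
  assumes "is_graph G" "u \<in> Defs.ball G v k" "adj G u w"
  shows "w \<in> Defs.ball G v (Suc k)"
  using assms gdist_le_trans[of G v u k w 1] gdist_adj[of G u w]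
  unfolding Defs.ball_def is_graph_def by auto

text \<open>A vertex that is new in the larger ball is reached by a walk of length exactly
  \<open>Suc k\<close>, whose penultimate vertex is the required neighbour.\<close>

lemma ball_Suc_cases:
  assumes "w \<in> Defs.ball G v (Suc k)" "w \<notin> Defs.ball G v k"
  obtains u where "u \<in> Defs.ball G v k" "adj G u w"
proof -
  obtain m where m: "m \<le> Suc k" "walk_len G v w m"
    using assms unfolding Defs.ball_def gdist_le_iff by blast
  have "m = Suc k"
    using assms m unfolding Defs.ball_def gdist_le_iff by (auto simp: le_Suc_eq)
  then obtain u where "walk_len G v u k" "adj G u w"
    using m walk_len_Suc_split by metis
  moreover from this have "u \<in> Defs.ball G v k"
    unfolding Defs.ball_def gdist_le_iff using walk_len_verts by fast
  ultimately show ?thesis using that by blast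
qed

section \<open>Balls in subcubic graphs with few branch vertices\<close>

text \<open>
  Every vertex of a sphere of positive radius has a neighbour closer to the centre, so passing to the
  next sphere increases the size at most by the number of vertices of degree three.
\<close>

lemma card_sphere_le:
  assumes G: "is_graph G" and v: "v \<in> verts G"
    and deg: "\<And>u. u \<in> verts G \<Longrightarrow> finite {w. adj G u w} \<and> card {w. adj G u w} \<le> 3"
  shows "finite (Defs.ball G v (Suc k)) \<and>
         card (Defs.ball G v (Suc k) - Defs.ball G v k)
           \<le> 2 + card {u \<in> Defs.ball G v k. card {w. adj G u w} > 2}"
proof (induction k)
  case 0
  have sub: "Defs.ball G v (Suc 0) - Defs.ball G v 0 \<subseteq> {w. adj G v w}"
  proof
    fix w assume "w \<in> Defs.ball G v (Suc 0) - Defs.ball G v 0"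
    then obtain u where "u \<in> Defs.ball G v 0" "adj G u w" using ball_Suc_cases by (metis DiffE)
    then show "w \<in> {w. adj G v w}" using ball_0[OF v] by simp
  qed
  have fin: "finite {w. adj G v w}" and le3: "card {w. adj G v w} \<le> 3" using deg v by auto
  have "finite (Defs.ball G v (Suc 0))"
    using finite_subset[OF sub fin] ball_0[OF v] by (metis finite.emptyI finite.insertI finite_Diff2)
  \<comment> \<open>The centre has no neighbour closer to itself, so all its edges count; a third
    one is paid for by the branch term.\<close>
  moreover have "card {w. adj G v w} \<le> 2 + card {u \<in> Defs.ball G v 0. card {w. adj G u w} > 2}"
  proof (cases "card {w. adj G v w} > 2")
    case True
    then have "{u \<in> Defs.ball G v 0. card {w. adj G u w} > 2} = {v}" using ball_0[OF v] by auto
    then show ?thesis using le3 by simp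
  qed simp
  ultimately show ?case using card_mono[OF fin sub] by linarith
next
  case (Suc k)
  let ?B = "Defs.ball G v"
  let ?N = "\<lambda>u. {w. adj G u w}"
  let ?S = "?B (Suc k) - ?B k" and ?T = "?B (Suc (Suc k)) - ?B (Suc k)"
  have finB: "finite (?B (Suc k))" using Suc by simp
  have finS: "finite ?S" using finB by simp
  have sub: "?T \<subseteq> (\<Union>u\<in>?S. ?N u - ?B (Suc k))"
  proof
    fix w assume w: "w \<in> ?T"
    then obtain u where u: "u \<in> ?B (Suc k)" "adj G u w" using ball_Suc_cases by (metis DiffE)
    \<comment> \<open>Otherwise \<open>w\<close> would already lie in
      \<open>?B (Suc k)\<close>.\<close>
    have "u \<notin> ?B k" using ball_adj[OF G _ u(2)] w by blast
    then show "w \<in> (\<Union>u\<in>?S. ?N u - ?B (Suc k))" using u w by blast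
  qed
  have Sv: "u \<in> verts G" if "u \<in> ?S" for u using that unfolding Defs.ball_def by auto
  have finU: "finite (\<Union>u\<in>?S. ?N u - ?B (Suc k))"
    using finS deg Sv by blast
  have fin: "finite (?B (Suc (Suc k)))"
    using finite_subset[OF sub finU] finB by (meson finite_Diff2)
  \<comment> \<open>One neighbour of \<open>u\<close> lies in \<open>?B k\<close>, so
    \<open>u\<close> leads to at most one new vertex, or two if it is a branch vertex.\<close>
  have cu: "card (?N u - ?B (Suc k)) \<le> 1 + (if card (?N u) > 2 then 1 else 0)" if u: "u \<in> ?S" for u
  proof -
    obtain w where w: "w \<in> ?B k" "adj G w u" using u ball_Suc_cases by (metis DiffE)
    then have "w \<in> ?N u" "w \<in> ?B (Suc k)"
      using G ball_mono[of k "Suc k" G v] unfolding is_graph_def by auto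
    then have "?N u - ?B (Suc k) \<subseteq> ?N u - {w}" "card (?N u - {w}) = card (?N u) - 1"
      using deg Sv[OF u] by auto
    then have "card (?N u - ?B (Suc k)) \<le> card (?N u) - 1"
      using deg[OF Sv[OF u]] by (metis card_mono finite_Diff)
    then show ?thesis using deg[OF Sv[OF u]] by auto
  qed
  have "card ?T \<le> card (\<Union>u\<in>?S. ?N u - ?B (Suc k))" by (rule card_mono[OF finU sub])
  also have "\<dots> \<le> (\<Sum>u\<in>?S. card (?N u - ?B (Suc k)))" by (rule card_UN_le[OF finS])
  also have "\<dots> \<le> (\<Sum>u\<in>?S. 1 + (if card (?N u) > 2 then 1 else 0))" by (rule sum_mono) (rule cu)
  also have "\<dots> = card ?S + card {u \<in> ?S. card (?N u) > 2}"
    unfolding sum.distrib using finS by (simp add: sum.If_cases Int_def conj_assoc)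
  \<comment> \<open>The induction hypothesis has counted the branch vertices in \<open>?B k\<close>;
    those in the sphere \<open>?S\<close> are disjoint from them and complete those of
    \<open>?B (Suc k)\<close>.\<close>
  also have "\<dots> \<le> 2 + card {u \<in> ?B k. card (?N u) > 2} + card {u \<in> ?S. card (?N u) > 2}"
    using Suc by simp
  also have "\<dots> = 2 + card ({u \<in> ?B k. card (?N u) > 2} \<union> {u \<in> ?S. card (?N u) > 2})"
    using finB finite_subset[OF ball_mono[of k "Suc k" G v] finB]
    by (subst card_Un_disjoint) auto
  also have "{u \<in> ?B k. card (?N u) > 2} \<union> {u \<in> ?S. card (?N u) > 2} = {u \<in> ?B (Suc k). card (?N u) > 2}"
    using ball_mono[of k "Suc k" G v] by auto
  finally show ?case using fin by simp
qed

text \<open>With at most one branch vertex in the ball, each sphere of positive radius has at most 2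
  + 1 vertices, and the centre adds one. This matches the lower bound assumed for
  \<open>f\<close>.\<close>

lemma card_ball_le_unique_branch:
  assumes G: "is_graph G" and v: "v \<in> verts G"
    and deg: "\<And>u. u \<in> verts G \<Longrightarrow> finite {w. adj G u w} \<and> card {w. adj G u w} \<le> 3"
    and uniq: "\<And>a b. \<lbrakk>a \<in> Defs.ball G v r; b \<in> Defs.ball G v r;
                 card {w. adj G a w} > 2; card {w. adj G b w} > 2\<rbrakk> \<Longrightarrow> a = b"
  shows "card (Defs.ball G v r) \<le> 3 * r + 1"
  using uniq
proof (induction r)
  case 0
  then show ?case by (simp add: ball_0[OF v])
next
  case (Suc r)
  let ?B = "Defs.ball G v"
  have mono: "?B r \<subseteq> ?B (Suc r)" by (rule ball_mono) simp
  have IH: "card (?B r) \<le> 3 * r + 1" using Suc mono by blast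
  have fin: "finite (?B (Suc r))" using card_sphere_le[OF G v deg, of r] by blast
  have "card {u \<in> ?B r. card {w. adj G u w} > 2} \<le> Suc 0"
    using Suc.prems mono finite_subset[OF mono fin]
    by (subst card_le_Suc0_iff_eq) auto
  then have "card (?B (Suc r) - ?B r) \<le> 3" using card_sphere_le[OF G v deg, of r] by linarith
  then show ?case
    using IH card_Diff_subset[OF finite_subset[OF mono fin] mono] by arith
qed

section \<open>A discrete Lebesgue covering theorem\<close>

text \<open>Each colour \<open>i\<close> gives a set \<open>S i\<close> that contains one face
  orthogonal to direction \<open>i\<close> and avoids the other. Kuhn's lemma finds a unit cell that
  meets every \<open>S i\<close> and every complement, and the corner \<open>q\<close> of this cell
  can then have no colour.\<close>

lemma lebesgue_covering_grid:
  fixes \<V> :: "nat \<Rightarrow> (nat \<Rightarrow> nat) set set"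
  assumes p: "M + 2 < p"
    and cover: "\<And>x. \<forall>i<d. x i \<le> p \<Longrightarrow> \<exists>i<d. \<exists>V\<in>\<V> i. x \<in> V"
    and disj: "\<And>i V W x y. \<lbrakk>i < d; V \<in> \<V> i; W \<in> \<V> i; x \<in> V; y \<in> W;
                 \<forall>j<d. x j \<le> y j + 2 \<and> y j \<le> x j + 2\<rbrakk> \<Longrightarrow> V = W"
    and bdd: "\<And>i V x y. \<lbrakk>i < d; V \<in> \<V> i; x \<in> V; y \<in> V\<rbrakk> \<Longrightarrow> x i \<le> y i + M"
  shows False
proof -
  define near where "near x y \<longleftrightarrow> (\<forall>j<d. x j \<le> y j + 1 \<and> y j \<le> x j + 1)" for x y :: "nat \<Rightarrow> nat"
  define inner where "inner i V \<longleftrightarrow> V \<in> \<V> i \<and> (\<exists>y\<in>V. y i \<le> 1)" for i V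
  txt \<open>The boundary of S i separates the two faces orthogonal to direction i and avoids colour i.\<close>
  define S where "S i = {x. x i = 0 \<or> (\<exists>V a. inner i V \<and> a \<in> V \<and> near x a)}" for i
  define label where "label x i = (if x \<in> S i then 0 else 1::nat)" for x i
  obtain q where q: "\<forall>i<d. q i < p"
    and rs: "\<forall>i<d. \<exists>r s. (\<forall>j<d. q j \<le> r j \<and> r j \<le> q j + 1) \<and>
                   (\<forall>j<d. q j \<le> s j \<and> s j \<le> q j + 1) \<and> label r i \<noteq> label s i"
  proof (rule kuhn_lemma[of p d label])
    show "\<forall>x. (\<forall>i<d. x i \<le> p) \<longrightarrow> (\<forall>i<d. x i = p \<longrightarrow> label x i = 1)"
    proof (intro allI impI)
      fix x i assume i: "i < d" "x i = p"
      have "x \<notin> S i"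
      proof
        assume "x \<in> S i"
        then obtain V a where Va: "inner i V" "a \<in> V" "near x a"
          using i p unfolding S_def by auto
        then obtain y where "V \<in> \<V> i" "y \<in> V" "y i \<le> 1" unfolding inner_def by blast
        \<comment> \<open>An inner set reaches coordinate at most \<open>M + 1\<close> and points
          near it at most \<open>M + 2\<close>, which is below \<open>p\<close>; so the far face
          gets label 1. The near face has label 0 by the definition of \<open>S\<close>.\<close>
        then have "a i \<le> 1 + M" using bdd[OF i(1) _ Va(2)] by fastforce
        moreover have "x i \<le> a i + 1" using Va(3) i(1) unfolding near_def by blast
        ultimately show False using p i(2) by linarith
      qed
      then show "label x i = 1" unfolding label_def by simp
    qed
  qed (use p in \<open>auto simp: label_def S_def\<close>)
  \<comment> \<open>The colour of \<open>q\<close> selects the direction whose two differently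
    labelled corners \<open>r\<close> and \<open>s\<close> lead to the contradiction.\<close>
  obtain i V where iV: "i < d" "V \<in> \<V> i" "q \<in> V" using cover[of q] q by (meson less_imp_le)
  obtain r s where r: "\<forall>j<d. q j \<le> r j \<and> r j \<le> q j + 1" "r \<in> S i"
    and s: "\<forall>j<d. q j \<le> s j \<and> s j \<le> q j + 1" "s \<notin> S i"
  proof -
    obtain r s where "\<forall>j<d. q j \<le> r j \<and> r j \<le> q j + 1" "\<forall>j<d. q j \<le> s j \<and> s j \<le> q j + 1"
      "label r i \<noteq> label s i" using rs iV(1) by blast
    then show thesis using that unfolding label_def by (metis (full_types))
  qed
  have "near s q" using s(1) unfolding near_def by (auto intro: le_SucI)
  \<comment> \<open>An inner \<open>V\<close> would force \<open>s\<close> into \<open>S i\<close>.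
    Hence \<open>q\<close>, and with it \<open>r\<close>, is off the face, so \<open>r\<close> can
    be in \<open>S i\<close> only by being near an inner set \<open>W\<close>.\<close>
  then have "\<not> inner i V" using s(2) iV unfolding S_def by blast
  then have qi: "q i > 1" using iV unfolding inner_def by (meson not_le)
  then have "r i \<noteq> 0" using r(1) iV(1) by fastforce
  then obtain W a where Wa: "inner i W" "a \<in> W" "near r a" using r(2) unfolding S_def by auto
  \<comment> \<open>Two unit steps, from \<open>q\<close> to \<open>r\<close> and from
    \<open>r\<close> to \<open>a\<close>: this is the distance 2 in \<open>disj\<close>.\<close>
  have "\<forall>j<d. q j \<le> a j + 2 \<and> a j \<le> q j + 2"
  proof (intro allI impI)
    fix j assume "j < d"
    then have "q j \<le> r j" "r j \<le> q j + 1" "r j \<le> a j + 1" "a j \<le> r j + 1"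
      using r(1) Wa(3) unfolding near_def by blast+
    then show "q j \<le> a j + 2 \<and> a j \<le> q j + 2" by linarith
  qed
  then have "V = W" using disj[OF iV(1,2) _ iV(3) Wa(2)] Wa(1) unfolding inner_def by blast
  then show False using Wa(1) \<open>\<not> inner i V\<close> by blast
qed

section \<open>The subdivided brick wall\<close>

text \<open>The graphs of the theorem have natural numbers as vertices, so points with coordinates 0
  to \<open>d\<close> are coded as numbers.\<close>

definition pt :: "nat \<Rightarrow> (nat \<Rightarrow> nat) \<Rightarrow> nat" where
  "pt d x = list_encode (map x [0..<Suc d])"

definition crd :: "nat \<Rightarrow> nat \<Rightarrow> nat" where
  "crd v i = list_decode v ! i"

lemma crd_pt: "i \<le> d \<Longrightarrow> crd (pt d x) i = x i"
  unfolding crd_def pt_def by (simp del: upt_Suc)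

lemma pt_eqI: "(\<And>i. i \<le> d \<Longrightarrow> x i = y i) \<Longrightarrow> pt d x = pt d y"
  unfolding pt_def by (auto simp del: upt_Suc intro!: arg_cong[of _ _ list_encode])

lemma pt_crd: "length (list_decode v) = Suc d \<Longrightarrow> pt d (crd v) = v"
proof -
  assume "length (list_decode v) = Suc d"
  then have "map (crd v) [0..<Suc d] = list_decode v"
    unfolding crd_def by (metis map_nth)
  then show ?thesis unfolding pt_def by simp
qed

text \<open>
  Coordinate d is a height. Over every point of the lattice with mesh l in the coordinates below d
  stands a vertical ray; a horizontal segment of length l in direction j joins neighbouring rays at a
  height that determines j and the parity of the position of the segment, so that at each height at
  most one segment ends at any given ray.
\<close>

definition on_wall :: "nat \<Rightarrow> nat \<Rightarrow> (nat \<Rightarrow> nat) \<Rightarrow> bool" where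
  "on_wall d l x \<longleftrightarrow>
     (\<forall>i<d. l dvd x i) \<or>
     (\<exists>j<d. (\<forall>i<d. i \<noteq> j \<longrightarrow> l dvd x i) \<and> x d = l * (2 * j + (x j div l) mod 2))"

text \<open>This is the subgraph of the integer grid in dimension d + 1 induced by the points on the
  wall.\<close>

definition wall :: "nat \<Rightarrow> nat \<Rightarrow> nat graph" where
  "wall d l =
     (let V = {v. length (list_decode v) = Suc d \<and> on_wall d l (crd v)}
      in \<lparr>verts = V,
          adj = (\<lambda>u v. u \<in> V \<and> v \<in> V \<and>
             (\<exists>i\<le>d. (\<forall>j\<le>d. j \<noteq> i \<longrightarrow> crd v j = crd u j) \<and>
                (crd v i = Suc (crd u i) \<or> crd u i = Suc (crd v i))))\<rparr>)"

lemma on_wall_cong: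
  "(\<And>i. i \<le> d \<Longrightarrow> x i = y i) \<Longrightarrow> on_wall d l x = on_wall d l y"
  unfolding on_wall_def by (metis less_imp_le_nat order_refl)

lemma wall_verts_iff:
  "v \<in> verts (wall d l) \<longleftrightarrow> length (list_decode v) = Suc d \<and> on_wall d l (crd v)"
  unfolding wall_def by (simp add: Let_def)

lemma wall_adj_iff:
  "adj (wall d l) u v \<longleftrightarrow> u \<in> verts (wall d l) \<and> v \<in> verts (wall d l) \<and>
     (\<exists>i\<le>d. (\<forall>j\<le>d. j \<noteq> i \<longrightarrow> crd v j = crd u j) \<and>
        (crd v i = Suc (crd u i) \<or> crd u i = Suc (crd v i)))"
  unfolding wall_def by (simp add: Let_def)

lemma pt_in_wall_iff: "pt d x \<in> verts (wall d l) \<longleftrightarrow> on_wall d l x"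
proof -
  have "on_wall d l (crd (pt d x)) = on_wall d l x" by (rule on_wall_cong) (rule crd_pt)
  then show ?thesis unfolding wall_verts_iff by (simp add: pt_def del: upt_Suc)
qed

lemma is_graph_wall: "is_graph (wall d l)"
  unfolding is_graph_def wall_adj_iff by (safe; metis n_not_Suc_n)

lemma wall_vert_eqI:
  assumes "u \<in> verts (wall d l)" "v \<in> verts (wall d l)" "\<And>i. i \<le> d \<Longrightarrow> crd u i = crd v i"
  shows "u = v"
  using assms pt_crd pt_eqI unfolding wall_verts_iff by metis

text \<open>An edge changes a single coordinate by one, so all coordinates are 1-Lipschitz. This
  bounds both the volume of balls and the extent of bounded sets.\<close>

lemma wall_walk_crd:
  assumes "walk_len (wall d l) u v k" "i \<le> d"
  shows "crd u i \<le> crd v i + k \<and> crd v i \<le> crd u i + k"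
  using assms(1)
proof (induction k arbitrary: v)
  case 0
  then show ?case by (simp add: walk_len_0_iff)
next
  case (Suc k)
  from Suc.prems obtain w where w: "walk_len (wall d l) u w k" "adj (wall d l) w v"
    by (rule walk_len_Suc_split)
  have "crd w i \<le> Suc (crd v i) \<and> crd v i \<le> Suc (crd w i)"
    using w(2) assms(2) unfolding wall_adj_iff by (metis le_SucI order_refl)
  then show ?case using Suc.IH[OF w(1)] by linarith
qed

lemma wall_gdist_crd:
  assumes "gdist (wall d l) u v \<le> enat k" "i \<le> d"
  shows "crd u i \<le> crd v i + k \<and> crd v i \<le> crd u i + k"
  using assms wall_walk_crd unfolding gdist_le_iff by fastforce

text \<open>The ball embeds into a box of side \<open>2 * r + 1\<close> by its coordinates. The
  bound does not involve \<open>l\<close>, so \<open>l\<close> can be chosen after it.\<close>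

lemma wall_ball_box:
  assumes "v \<in> verts (wall d l)"
  shows "finite (Defs.ball (wall d l) v r) \<and> card (Defs.ball (wall d l) v r) \<le> (2 * r + 1) ^ Suc d"
proof -
  let ?B = "Defs.ball (wall d l) v r"
  let ?P = "PiE {..d} (\<lambda>i. {crd v i - r..crd v i + r})"
  let ?h = "\<lambda>u. restrict (crd u) {..d}"
  have inj: "inj_on ?h ?B"
  proof (rule inj_onI)
    fix a b assume ab: "a \<in> ?B" "b \<in> ?B" "?h a = ?h b"
    have "crd a i = crd b i" if "i \<le> d" for i
      using fun_cong[OF ab(3), of i] that by simp
    then show "a = b" using ab(1,2) unfolding Defs.ball_def by (intro wall_vert_eqI[of a d l b]) auto
  qed
  have im: "?h ` ?B \<subseteq> ?P"
  proof (intro image_subsetI restrict_PiE_iff[THEN iffD2] ballI)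
    fix u i assume "u \<in> ?B" "i \<in> {..d}"
    then have "crd v i \<le> crd u i + r \<and> crd u i \<le> crd v i + r"
      using wall_gdist_crd[of d l v u r i] unfolding Defs.ball_def by simp
    then show "crd u i \<in> {crd v i - r..crd v i + r}" by auto
  qed
  have finP: "finite ?P" by (rule finite_PiE) auto
  have "card ?P = (\<Prod>i\<le>d. card {crd v i - r..crd v i + r})" by (rule card_PiE) simp
  \<comment> \<open>Truncated subtraction may shorten an interval, hence only an inequality.\<close>
  also have "\<dots> \<le> (\<Prod>i\<le>d. 2 * r + 1)" by (rule prod_mono) auto
  finally have "card ?P \<le> (2 * r + 1) ^ Suc d" by simp
  moreover have "card ?B \<le> card ?P" using card_inj_on_le[OF inj im finP] .
  moreover have "finite ?B" using inj im finP by (meson finite_imageD finite_subset)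
  ultimately show ?thesis by linarith
qed

section \<open>Neighbours and branch vertices in the wall\<close>

lemma not_dvd_adjacent:
  fixes l a b :: nat
  assumes "2 \<le> l" "l dvd a" "b = Suc a \<or> a = Suc b"
  shows "\<not> l dvd b"
proof
  assume "l dvd b"
  then have "l dvd Suc 0" using assms by (metis dvd_diff_nat diff_Suc_Suc One_nat_def diff_add_inverse plus_1_eq_Suc add.commute)
  then show False using assms(1) by simp
qed

text \<open>Explicit terms for the neighbours turn degree bounds into inclusions in small
  sets.\<close>

lemma wall_nbh_eq_pt:
  assumes "adj (wall d l) u v"
  obtains i where "i \<le> d" "v = pt d ((crd u)(i := Suc (crd u i))) \<or> v = pt d ((crd u)(i := crd u i - 1))"
    "\<forall>j\<le>d. j \<noteq> i \<longrightarrow> crd v j = crd u j"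
    "crd v i = Suc (crd u i) \<or> crd u i = Suc (crd v i)"
    "v = pt d ((crd u)(i := crd v i))"
proof -
  obtain i where i: "i \<le> d" "\<forall>j\<le>d. j \<noteq> i \<longrightarrow> crd v j = crd u j"
    "crd v i = Suc (crd u i) \<or> crd u i = Suc (crd v i)" and v: "v \<in> verts (wall d l)"
    using assms unfolding wall_adj_iff by blast
  have "v = pt d (crd v)" using v pt_crd unfolding wall_verts_iff by simp
  also have "\<dots> = pt d ((crd u)(i := crd v i))" by (rule pt_eqI) (use i in auto)
  finally have e: "v = pt d ((crd u)(i := crd v i))" .
  have "crd v i = Suc (crd u i) \<or> crd v i = crd u i - 1" using i(3) by auto
  then show thesis using that[of i] i e by metis
qed

lemma card_pair_le: "A \<subseteq> {a, b} \<Longrightarrow> card A \<le> 2"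
  by (rule order.trans[OF card_mono[of "{a,b}"]]) (auto simp: card_insert_if)

text \<open>The point is interior to a segment in direction \<open>k\<close>, so its other
  coordinates, the height included, are multiples of \<open>l\<close>. A step in another direction
  would stay interior to such a segment and make two consecutive numbers multiples of
  \<open>l\<close>.\<close>

lemma wall_nbhs_segment:
  assumes l: "2 \<le> l" and k: "k < d" "\<not> l dvd crd u k" and a: "adj (wall d l) u v"
  shows "v \<in> {pt d ((crd u)(k := Suc (crd u k))), pt d ((crd u)(k := crd u k - 1))}"
proof -
  from a obtain i where i: "i \<le> d"
    "v = pt d ((crd u)(i := Suc (crd u i))) \<or> v = pt d ((crd u)(i := crd u i - 1))"
    "\<forall>j\<le>d. j \<noteq> i \<longrightarrow> crd v j = crd u j"
    "crd v i = Suc (crd u i) \<or> crd u i = Suc (crd v i)"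
    "v = pt d ((crd u)(i := crd v i))"
    by (rule wall_nbh_eq_pt)
  have u: "on_wall d l (crd u)" and v: "on_wall d l (crd v)"
    using a unfolding wall_adj_iff wall_verts_iff by auto
  have du: "l dvd crd u d" "\<And>j. j < d \<Longrightarrow> j \<noteq> k \<Longrightarrow> l dvd crd u j"
    using u k unfolding on_wall_def by (metis dvd_triv_left)+
  have "i = k"
  proof (rule ccontr)
    assume ik: "i \<noteq> k"
    then have vk: "\<not> l dvd crd v k" using i(3) k by simp
    then have dv: "l dvd crd v d" "\<And>j. j < d \<Longrightarrow> j \<noteq> k \<Longrightarrow> l dvd crd v j"
      using v k unfolding on_wall_def by (metis dvd_triv_left)+
    have "l dvd crd u i" "l dvd crd v i" using ik i(1) du dv by (cases "i = d"; simp)+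
    then show False using not_dvd_adjacent[OF l _ i(4)] by blast
  qed
  then show ?thesis using i(2) by blast
qed

text \<open>Besides the two vertical neighbours there is at most one horizontal candidate: the
  height divided by \<open>l\<close> is twice the direction plus a parity, and the parity decides
  between the segment to the right and the one to the left.\<close>

lemma wall_nbhs_ray:
  assumes l: "2 \<le> l" and u: "\<And>j. j < d \<Longrightarrow> l dvd crd u j" and a: "adj (wall d l) u v"
  shows "v \<in> {pt d ((crd u)(d := Suc (crd u d))), pt d ((crd u)(d := crd u d - 1))} \<or>
     (l dvd crd u d \<and>
      v = (let j = crd u d div l div 2; y = crd u j in
             pt d ((crd u)(j := (if (y div l) mod 2 = (crd u d div l) mod 2 then Suc y else y - 1)))))"
proof -
  from a obtain i where i: "i \<le> d"
    "v = pt d ((crd u)(i := Suc (crd u i))) \<or> v = pt d ((crd u)(i := crd u i - 1))"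
    "\<forall>j\<le>d. j \<noteq> i \<longrightarrow> crd v j = crd u j"
    "crd v i = Suc (crd u i) \<or> crd u i = Suc (crd v i)"
    "v = pt d ((crd u)(i := crd v i))"
    by (rule wall_nbh_eq_pt)
  have v: "on_wall d l (crd v)"
    using a unfolding wall_adj_iff wall_verts_iff by auto
  show ?thesis
  proof (cases "i = d")
    case True
    then show ?thesis using i(2) by blast
  next
    case False
    then have id: "i < d" using i(1) by simp
    have nv: "\<not> l dvd crd v i" using not_dvd_adjacent[OF l u[OF id] i(4)] .
    \<comment> \<open>Having left the lattice in direction \<open>i\<close>, \<open>v\<close> is
      interior to a segment, whose height is prescribed.\<close>
    then have "crd v d = l * (2 * i + (crd v i div l) mod 2)"
      using v id unfolding on_wall_def by blast
    then have h: "crd u d = l * (2 * i + (crd v i div l) mod 2)" using i(3) False by simp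
    have hl: "crd u d div l = 2 * i + (crd v i div l) mod 2" using h l by simp
    have j: "crd u d div l div 2 = i" using hl by simp
    have t: "(crd u d div l) mod 2 = (crd v i div l) mod 2" using hl by simp
    obtain m where m: "crd u i = l * m" using u[OF id] by blast
    have um: "crd u i div l = m" using m l by simp
    have "crd v i = (if (crd u i div l) mod 2 = (crd u d div l) mod 2 then Suc (crd u i) else crd u i - 1)"
    proof (cases "crd v i = Suc (crd u i)")
      case True
      then have "crd v i div l = m" using m l by (simp add: div_nat_eqI)
      then show ?thesis using True t um by simp
    next
      case False
      then have e: "crd u i = Suc (crd v i)" using i(4) by simp
      then obtain m' where m': "m = Suc m'" using m by (cases m) auto
      \<comment> \<open>The left neighbour is the last point of the preceding segment, whose
        position has the opposite parity.\<close>
      have "crd v i = l * m' + (l - 1)" using e m m' l by auto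
      then have "crd v i div l = m'" using l by (simp add: div_nat_eqI)
      then have "(crd u i div l) mod 2 \<noteq> (crd u d div l) mod 2"
        unfolding t um m' by (simp add: mod_Suc)
      then show ?thesis using e by simp
    qed
    then have "v = (let j = crd u d div l div 2; y = crd u j in
             pt d ((crd u)(j := (if (y div l) mod 2 = (crd u d div l) mod 2 then Suc y else y - 1))))"
      using i(5) j by (simp add: Let_def)
    then show ?thesis using h by simp
  qed
qed

text \<open>Interior points of segments, and points of rays at heights not divisible by
  \<open>l\<close>, have at most two neighbours. A third one can occur only where every coordinate
  is a multiple of \<open>l\<close>.\<close>

lemma wall_degree:
  assumes l: "2 \<le> l"
  shows "finite {w. adj (wall d l) u w} \<and> card {w. adj (wall d l) u w} \<le> 3"
    and "card {w. adj (wall d l) u w} > 2 \<Longrightarrow> i \<le> d \<Longrightarrow> l dvd crd u i"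
proof -
  let ?N = "{w. adj (wall d l) u w}"
  have le2: "finite ?N \<and> card ?N \<le> 2" if "?N \<subseteq> {a, b}" for a b
    using that by (meson card_pair_le finite.emptyI finite.insertI finite_subset)
  have seg: "finite ?N \<and> card ?N \<le> 2" if "k < d" "\<not> l dvd crd u k" for k
    using wall_nbhs_segment[OF l that] by (intro le2) blast
  have ray: "finite ?N \<and> card ?N \<le> 2" if "\<And>j. j < d \<Longrightarrow> l dvd crd u j" "\<not> l dvd crd u d"
    using wall_nbhs_ray[OF l that(1)] that(2) by (intro le2) blast
  have "finite ?N \<and> card ?N \<le> 3" if dv: "\<And>j. j < d \<Longrightarrow> l dvd crd u j"
  proof -
    obtain a b c where "?N \<subseteq> {a, b, c}"
    proof
      show "?N \<subseteq> {pt d ((crd u)(d := Suc (crd u d))), pt d ((crd u)(d := crd u d - 1)),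
        (let j = crd u d div l div 2; y = crd u j in
           pt d ((crd u)(j := (if (y div l) mod 2 = (crd u d div l) mod 2 then Suc y else y - 1))))}"
        using wall_nbhs_ray[OF l dv] by blast
    qed
    moreover have "card {a, b, c} \<le> 3" by (auto simp: card_insert_if)
    ultimately show ?thesis
      by (meson card_mono finite.emptyI finite.insertI finite_subset order.trans)
  qed
  then show "finite ?N \<and> card ?N \<le> 3" using seg by fastforce
  show "l dvd crd u i" if "card ?N > 2" "i \<le> d"
    using that seg ray by (metis le_neq_implies_less not_le)
qed

text \<open>Distinct branch vertices differ by at least \<open>l\<close> in some coordinate, but two
  points of the ball differ by at most \<open>2 * r < l\<close>.\<close>

lemma wall_small_ball:
  assumes l: "2 \<le> l" "2 * r < l" and v: "v \<in> verts (wall d l)"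
  shows "card (Defs.ball (wall d l) v r) \<le> 3 * r + 1"
proof (rule card_ball_le_unique_branch[OF is_graph_wall v])
  fix a b
  assume a: "a \<in> Defs.ball (wall d l) v r" "card {w. adj (wall d l) a w} > 2"
    and b: "b \<in> Defs.ball (wall d l) v r" "card {w. adj (wall d l) b w} > 2"
  have "crd a i = crd b i" if i: "i \<le> d" for i
  proof -
    obtain m n where mn: "crd a i = l * m" "crd b i = l * n"
      using wall_degree(2)[OF l(1) a(2) i] wall_degree(2)[OF l(1) b(2) i] by blast
    have "crd v i \<le> crd a i + r \<and> crd a i \<le> crd v i + r" "crd v i \<le> crd b i + r \<and> crd b i \<le> crd v i + r"
      using a(1) b(1) wall_gdist_crd[OF _ i] unfolding Defs.ball_def by blast+
    then have "l * m < l * n + l" "l * n < l * m + l" using l(2) mn by linarith+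
    then have "l * m < l * Suc n" "l * n < l * Suc m" by simp_all
    then have "m = n" using l(1) by (metis less_Suc_eq_le mult_less_cancel1 order_antisym)
    then show ?thesis using mn by simp
  qed
  then show "a = b" using a(1) b(1) unfolding Defs.ball_def by (intro wall_vert_eqI[of a d l b]) auto
qed (use wall_degree(1)[OF l(1)] in auto)

section \<open>The coarse copy of the grid inside the wall\<close>

lemma wall_straight_line:
  assumes i: "i \<le> d" and on: "\<And>k. k \<le> m \<Longrightarrow> on_wall d l (x(i := x i + k))"
  shows "gdist (wall d l) (pt d x) (pt d (x(i := x i + m))) \<le> enat m"
  using on
proof (induction m)
  case 0
  then have "pt d x \<in> verts (wall d l)" using pt_in_wall_iff[of d x l] by fastforce
  then show ?case unfolding gdist_le_iff by (auto simp: walk_len_0_iff)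
next
  case (Suc m)
  have "adj (wall d l) (pt d (x(i := x i + m))) (pt d (x(i := x i + Suc m)))"
    unfolding wall_adj_iff pt_in_wall_iff
  proof (intro conjI exI[of _ i])
    show "on_wall d l (x(i := x i + m))" "on_wall d l (x(i := x i + Suc m))"
      by (rule Suc.prems, simp)+
  qed (use i in \<open>auto simp: crd_pt\<close>)
  then have "gdist (wall d l) (pt d (x(i := x i + m))) (pt d (x(i := x i + Suc m))) \<le> enat 1"
    by (rule gdist_adj[OF is_graph_wall])
  moreover have "gdist (wall d l) (pt d x) (pt d (x(i := x i + m))) \<le> enat m"
    by (rule Suc.IH) (rule Suc.prems, simp)
  ultimately show ?case using gdist_le_trans by (metis Suc_eq_plus1)
qed

text \<open>The foot, at height 0, of the ray over the grid point \<open>x\<close> scaled by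
  \<open>l\<close>.\<close>

definition node :: "nat \<Rightarrow> nat \<Rightarrow> (nat \<Rightarrow> nat) \<Rightarrow> nat" where
  "node d l x = pt d (\<lambda>i. if i < d then l * x i else 0)"

lemma node_cong: "(\<And>i. i < d \<Longrightarrow> x i = y i) \<Longrightarrow> node d l x = node d l y"
  unfolding node_def by (rule pt_eqI) simp

lemma node_in_wall: "node d l x \<in> verts (wall d l)"
  unfolding node_def pt_in_wall_iff by (simp add: on_wall_def)

lemma crd_node: "i < d \<Longrightarrow> crd (node d l x) i = l * x i"
  unfolding node_def by (simp add: crd_pt)

text \<open>The path climbs the ray to the segment in direction \<open>j\<close>, crosses it and
  descends the next ray.\<close>

lemma node_step:
  assumes j: "j < d" and l: "0 < l"
  shows "gdist (wall d l) (node d l x) (node d l (x(j := Suc (x j)))) \<le> enat ((4 * d + 1) * l)"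
proof -
  define h where "h = l * (2 * j + x j mod 2)"
  define P where "P y t = (\<lambda>i. if i < d then l * y i else t)" for y :: "nat \<Rightarrow> nat" and t
  let ?y = "x(j := Suc (x j))"
  have node: "node d l z = pt d (P z 0)" for z unfolding node_def P_def by simp
  \<comment> \<open>As \<open>j\<close> is at most d - 1, all segments lie below height
    \<open>2 * d * l\<close>; two vertical stretches and one crossing give
    \<open>(4 * d + 1) * l\<close>.\<close>
  have "2 * j + x j mod 2 \<le> 2 * d" using j by auto
  then have hle: "h \<le> 2 * d * l" unfolding h_def by (metis mult.commute mult_le_mono2)
  have ver: "gdist (wall d l) (pt d (P z 0)) (pt d (P z h)) \<le> enat h" for z
  proof -
    have "gdist (wall d l) (pt d (P z 0)) (pt d ((P z 0)(d := P z 0 d + h))) \<le> enat h"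
      by (rule wall_straight_line) (auto simp: on_wall_def P_def)
    moreover have "pt d ((P z 0)(d := P z 0 d + h)) = pt d (P z h)"
      by (rule pt_eqI) (auto simp: P_def)
    ultimately show ?thesis by simp
  qed
  have hor: "gdist (wall d l) (pt d (P x h)) (pt d (P ?y h)) \<le> enat l"
  proof -
    have "gdist (wall d l) (pt d (P x h)) (pt d ((P x h)(j := P x h j + l))) \<le> enat l"
    proof (rule wall_straight_line)
      fix k assume k: "k \<le> l"
      show "on_wall d l ((P x h)(j := P x h j + k))"
      \<comment> \<open>The far end is on the next ray, where the position has the other parity, so
        it belongs to the wall as a ray point.\<close>
      proof (cases "k = l")
        case True
        then show ?thesis using j by (auto simp: on_wall_def P_def)
      next
        case False
        then have "(l * x j + k) div l = x j" using k l by (simp add: div_nat_eqI)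
        then show ?thesis using j unfolding on_wall_def
          by (intro disjI2 exI[of _ j]) (auto simp: P_def h_def)
      qed
    qed (use j in simp)
    moreover have "pt d ((P x h)(j := P x h j + l)) = pt d (P ?y h)"
      by (rule pt_eqI) (use j in \<open>auto simp: P_def\<close>)
    ultimately show ?thesis by simp
  qed
  have "gdist (wall d l) (node d l x) (node d l ?y) \<le> enat (h + l + h)"
    unfolding node
    using gdist_le_trans[OF gdist_le_trans[OF ver hor]] ver gdist_sym[OF is_graph_wall] by metis
  then show ?thesis
  proof (rule gdist_le_mono)
    show "h + l + h \<le> (4 * d + 1) * l" using hle by (simp add: algebra_simps)
  qed
qed

lemma node_steps:
  assumes "j < d" "0 < l"
  shows "gdist (wall d l) (node d l x) (node d l (x(j := x j + m))) \<le> enat (m * ((4 * d + 1) * l))"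
proof (induction m)
  case 0
  then show ?case using node_in_wall[of d l x] unfolding gdist_le_iff by (auto simp: walk_len_0_iff)
next
  case (Suc m)
  have "gdist (wall d l) (node d l (x(j := x j + m))) (node d l (x(j := x j + Suc m))) \<le> enat ((4 * d + 1) * l)"
    using node_step[OF assms, of "x(j := x j + m)"] by simp
  from gdist_le_trans[OF Suc this] show ?case by (metis add.commute mult_Suc)
qed

lemma node_change_coordinate:
  assumes j: "j < d" and l: "0 < l" and "x j \<le> b + c" "b \<le> x j + c"
  shows "gdist (wall d l) (node d l x) (node d l (x(j := b))) \<le> enat (c * ((4 * d + 1) * l))"
proof (cases "x j \<le> b")
  case True
  then have "gdist (wall d l) (node d l x) (node d l (x(j := b))) \<le> enat ((b - x j) * ((4 * d + 1) * l))"
    using node_steps[OF j l, of x "b - x j"] by simp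
  then show ?thesis by (rule gdist_le_mono) (use assms in \<open>intro mult_le_mono1; simp\<close>)
next
  case False
  then have "gdist (wall d l) (node d l (x(j := b))) (node d l x) \<le> enat ((x j - b) * ((4 * d + 1) * l))"
    using node_steps[OF j l, of "x(j := b)" "x j - b"] by simp
  then have "gdist (wall d l) (node d l x) (node d l (x(j := b))) \<le> enat ((x j - b) * ((4 * d + 1) * l))"
    using gdist_sym[OF is_graph_wall] by metis
  then show ?thesis by (rule gdist_le_mono) (use assms in \<open>intro mult_le_mono1; simp\<close>)
qed

text \<open>The coordinates are exchanged one after another through the hybrids \<open>z m\<close>,
  each exchange costing at most \<open>c\<close> node steps.\<close>

lemma node_gdist_le:
  assumes l: "0 < l" and xy: "\<And>j. j < d \<Longrightarrow> x j \<le> y j + c \<and> y j \<le> x j + c"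
  shows "gdist (wall d l) (node d l x) (node d l y) \<le> enat (d * (c * ((4 * d + 1) * l)))"
proof -
  define z where "z m = (\<lambda>j. if j < m then y j else x j)" for m
  have "gdist (wall d l) (node d l x) (node d l (z m)) \<le> enat (m * (c * ((4 * d + 1) * l)))"
    if "m \<le> d" for m
    using that
  proof (induction m)
    case 0
    then show ?case using node_in_wall[of d l x] unfolding gdist_le_iff z_def
      by (auto simp: walk_len_0_iff)
  next
    case (Suc m)
    have e: "z (Suc m) = (z m)(m := y m)" unfolding z_def by (auto simp: fun_eq_iff)
    have "gdist (wall d l) (node d l (z m)) (node d l (z (Suc m))) \<le> enat (c * ((4 * d + 1) * l))"
      unfolding e by (rule node_change_coordinate) (use Suc.prems xy l in \<open>auto simp: z_def\<close>)
    from gdist_le_trans[OF Suc.IH this] Suc.prems show ?case by (simp add: add.commute)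
  qed
  moreover have "node d l (z d) = node d l y" by (rule node_cong) (simp add: z_def)
  ultimately show ?thesis by (metis order_refl)
qed

text \<open>A cover at the single scale \<open>K\<close> pulls back along \<open>node\<close> to n +
  1 families on the grid of dimension n + 1, which the covering theorem excludes for every
  \<open>D\<close>.\<close>

lemma wall_no_control_function:
  assumes l: "0 < l"
  shows "\<not> control_function (wall (Suc n) l) n D"
proof
  assume ctrl: "control_function (wall (Suc n) l) n D"
  let ?d = "Suc n"
  let ?G = "wall ?d l"
  \<comment> \<open>The bound of \<open>node_gdist_le\<close> for c = 2, so that grid points at
    maximum distance 2 in the same colour lie in the same set.\<close>
  define K where "K = ?d * (2 * ((4 * ?d + 1) * l))"
  have "K > 0" using l unfolding K_def by simp
  then have "real K > 0" by simp
  then obtain \<U> where cover: "verts ?G = (\<Union>i\<le>n. \<Union>(\<U> i))"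
    and rb: "\<And>i. i \<le> n \<Longrightarrow> r_disjoint ?G (real K) (\<U> i) \<and> D_bounded ?G (D (real K)) (\<U> i)"
    using ctrl unfolding control_function_def by meson
  define M where "M = nat \<lceil>D (real K)\<rceil>"
  define \<V> where "\<V> i = (\<lambda>U. {x. node ?d l x \<in> U}) ` \<U> i" for i
  show False
  proof (rule lebesgue_covering_grid[of M "M + 3" ?d \<V>])
    fix x :: "nat \<Rightarrow> nat"
    obtain i U where "i \<le> n" "U \<in> \<U> i" "node ?d l x \<in> U"
      using cover node_in_wall[of ?d l x] by auto
    then show "\<exists>i<?d. \<exists>V\<in>\<V> i. x \<in> V" unfolding \<V>_def by (auto simp: less_Suc_eq_le)
  next
    fix i V W x y
    assume i: "i < ?d" and V: "V \<in> \<V> i" "W \<in> \<V> i" "x \<in> V" "y \<in> W"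
      and near: "\<forall>j<?d. x j \<le> y j + 2 \<and> y j \<le> x j + 2"
    obtain U U' where U: "U \<in> \<U> i" "V = {x. node ?d l x \<in> U}" "U' \<in> \<U> i" "W = {x. node ?d l x \<in> U'}"
      using V unfolding \<V>_def by blast
    have le: "gdist ?G (node ?d l x) (node ?d l y) \<le> enat K"
      unfolding K_def using near by (intro node_gdist_le[OF l]) blast
    then obtain k where k: "gdist ?G (node ?d l x) (node ?d l y) = enat k" "k \<le> K"
      by (cases "gdist ?G (node ?d l x) (node ?d l y)") auto
    have "U = U'"
    proof (rule ccontr)
      assume "U \<noteq> U'"
      then have "real k > real K"
        using rb[of i] i U V k(1) unfolding r_disjoint_def by (simp add: less_Suc_eq_le)
      then show False using k(2) by simp
    qed
    then show "V = W" using U by simp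
  next
    fix i V x y
    assume i: "i < ?d" and V: "V \<in> \<V> i" "x \<in> V" "y \<in> V"
    obtain U where U: "U \<in> \<U> i" "node ?d l x \<in> U" "node ?d l y \<in> U"
      using V unfolding \<V>_def by blast
    then obtain k where k: "gdist ?G (node ?d l x) (node ?d l y) = enat k" "real k \<le> D (real K)"
      using rb[of i] i unfolding D_bounded_def by (meson less_Suc_eq_le)
    have "k \<le> M" unfolding M_def using k(2) by linarith
    have "l * x i \<le> l * y i + k"
      using wall_gdist_crd[of ?d l "node ?d l x" "node ?d l y" k i] k(1) i by (simp add: crd_node)
    \<comment> \<open>Uses \<open>l\<close> at least 1; cancelling \<open>l\<close> then bounds the
      extent on the grid by \<open>M\<close>.\<close>
    also have "\<dots> \<le> l * (y i + M)" using \<open>k \<le> M\<close> l by (simp add: distrib_left order.trans[of k M "l * M"])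
    finally show "x i \<le> y i + M" using l by simp
  qed simp
qed

section \<open>Superpolynomial growth and the choice of the subdivision length\<close>

lemma superpolynomial_eventually_ge:
  assumes "superpolynomial f"
  shows "\<exists>R. \<forall>r\<ge>R. real ((2 * r + 1) ^ m) \<le> f r"
proof -
  obtain g where g: "filterlim g at_top sequentially" "\<forall>\<^sub>F r in sequentially. f r = real r powr g r"
    using assms unfolding superpolynomial_def by blast
  \<comment> \<open>The exponent 2 m suffices because \<open>2 * r + 1\<close> is at most the square
    of \<open>r\<close> once \<open>r\<close> is at least 3.\<close>
  have "\<forall>\<^sub>F r in sequentially. real (2 * m) \<le> g r"
    using g(1) unfolding filterlim_at_top by blast
  with g(2) eventually_ge_at_top[of 3]
  have "\<forall>\<^sub>F r in sequentially. real ((2 * r + 1) ^ m) \<le> f r"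
  proof eventually_elim
    case (elim r)
    have "2 * r + 1 \<le> 3 * r" using elim by linarith
    also have "\<dots> \<le> r ^ 2" using elim by (simp add: power2_eq_square)
    finally have "(2 * r + 1) ^ m \<le> (r ^ 2) ^ m" by (rule power_mono) simp
    then have "real ((2 * r + 1) ^ m) \<le> real (r ^ (2 * m))"
      unfolding power_mult of_nat_le_iff .
    also have "\<dots> = real r powr real (2 * m)" using elim by (simp add: powr_realpow del: of_nat_mult)
    also have "\<dots> \<le> real r powr g r" using elim by (intro powr_mono) auto
    finally show ?case using elim by simp
  qed
  then show ?thesis unfolding eventually_sequentially .
qed

theorem theorem6p5:
  fixes f :: "nat \<Rightarrow> real"
  assumes "superpolynomial f"
    and "\<forall>r. f r \<ge> 3 * real r + 1"
  shows "\<forall>n. \<not> asdim_class_le (\<lambda>G :: nat graph. is_graph G \<and> growth_at_most f G) n"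
proof
  fix n
  \<comment> \<open>The exponent n + 2 is the number of coordinates of a point of
    \<open>wall (Suc n) l\<close>.\<close>
  obtain R where R: "\<forall>r\<ge>R. real ((2 * r + 1) ^ Suc (Suc n)) \<le> f r"
    using superpolynomial_eventually_ge[OF assms(1)] by blast
  \<comment> \<open>Makes \<open>l\<close> exceed twice every radius below \<open>R\<close>, where
    the branch vertex argument applies; from \<open>R\<close> on the box bound suffices.\<close>
  define l where "l = 2 * R + 2"
  have "growth_at_most f (wall (Suc n) l)"
    unfolding growth_at_most_def
  proof (intro allI ballI conjI)
    fix r v assume v: "v \<in> verts (wall (Suc n) l)"
    note box = wall_ball_box[OF v, of r]
    show "finite (Defs.ball (wall (Suc n) l) v r)" using box by blast
    show "real (card (Defs.ball (wall (Suc n) l) v r)) \<le> f r"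
    proof (cases "R \<le> r")
      case True
      have "real (card (Defs.ball (wall (Suc n) l) v r)) \<le> real ((2 * r + 1) ^ Suc (Suc n))"
        using box unfolding of_nat_le_iff by blast
      then show ?thesis using R True by (meson order.trans)
    next
      case False
      then have "card (Defs.ball (wall (Suc n) l) v r) \<le> 3 * r + 1"
        by (intro wall_small_ball v) (auto simp: l_def)
      then have "real (card (Defs.ball (wall (Suc n) l) v r)) \<le> 3 * real r + 1" by linarith
      then show ?thesis using assms(2) by (meson order.trans)
    qed
  qed
  \<comment> \<open>This one wall refutes every candidate \<open>D\<close>, so no common control
    function exists.\<close>
  moreover have "\<not> control_function (wall (Suc n) l) n D" for D
    by (rule wall_no_control_function) (simp add: l_def)
  ultimately show "\<not> asdim_class_le (\<lambda>G :: nat graph. is_graph G \<and> growth_at_most f G) n"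
    unfolding asdim_class_le_def using is_graph_wall by blast
qed

end
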